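(* Write $e_{i,j,k}=e_i\otimes e_j\otimes e_k$ for the standard basis of $\mathbb{C}^3\otimes\mathbb{C}^3\otimes\mathbb{C}^3$. The tensors \[ \mathsf{T}_2 = e_{1,2,3} + e_{1,3,2} + e_{2,1,3} + e_{2,2,1} + e_{2,2,2} + e_{3,1,1} \] and \[ \mathsf{T}_5 = e_{1,1,3} + e_{1,3,1} + e_{1,3,2} + e_{2,2,1} + e_{3,1,2} \] are not free.
   Context: For $T=\sum T_{i,j,k}\, e_{i,j,k}\in \mathbb{C}^3\otimes\mathbb{C}^3\otimes\mathbb{C}^3$, its support is $\operatorname{supp}(T)=\{(i,j,k)\in\{1,2,3\}^3 \mid T_{i,j,k}\neq 0\}$. A set of triples is called free if any two distinct elements of it differ in at least two coordinates. A tensor $T$ is called free if there exist $g_1,g_2,g_3\in \mathrm{GL}_3(\mathbb{C})$ such that $\operatorname{supp}((g_1\otimes g_2\otimes g_3)T)$ is free. *)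

theory Defs
  imports "HOL-Analysis.Cartesian_Space"
begin

text \<open>
  Tensors in \<open>C\<^sup>3 \<otimes> C\<^sup>3 \<otimes> C\<^sup>3\<close> are represented by their coordinate arrays
  \<open>T $ i $ j $ k\<close> in the standard basis. The coordinates are indexed by the three-element
  numeral type \<open>3\<close>, whose elements are \<open>1\<close>, \<open>2\<close> and \<open>3\<close> (where \<open>3 = 0\<close>).
\<close>

type_synonym tensor = "complex ^ 3 ^ 3 ^ 3"

definition pure_tensor :: "complex ^ 3 \<Rightarrow> complex ^ 3 \<Rightarrow> complex ^ 3 \<Rightarrow> tensor" where
  "pure_tensor u v w = (\<chi> i j k. u $ i * v $ j * w $ k)"

definition tensor_basis :: "3 \<Rightarrow> 3 \<Rightarrow> 3 \<Rightarrow> tensor" where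
  "tensor_basis i j k = pure_tensor (axis i 1) (axis j 1) (axis k 1)"

text \<open>
  The map \<open>A \<otimes> B \<otimes> C\<close> in coordinates; it is the linear extension of its values on pure tensors,
  see \<open>tensor_act_pure_tensor\<close> below.
\<close>

definition tensor_act ::
    "complex ^ 3 ^ 3 \<Rightarrow> complex ^ 3 ^ 3 \<Rightarrow> complex ^ 3 ^ 3 \<Rightarrow> tensor \<Rightarrow> tensor" where
  "tensor_act A B C T =
     (\<chi> i j k. \<Sum>a\<in>UNIV. \<Sum>b\<in>UNIV. \<Sum>c\<in>UNIV. A $ i $ a * B $ j $ b * C $ k $ c * T $ a $ b $ c)"

lemma tensor_act_pure_tensor:
  "tensor_act A B C (pure_tensor u v w) = pure_tensor (A *v u) (B *v v) (C *v w)"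
  by (simp add: tensor_act_def pure_tensor_def matrix_vector_mult_def vec_eq_iff
      sum_distrib_left sum_distrib_right mult_ac sum_3 algebra_simps)

definition tensor_supp :: "tensor \<Rightarrow> (3 \<times> 3 \<times> 3) set" where
  "tensor_supp T = {(i, j, k). T $ i $ j $ k \<noteq> 0}"

definition free_triples :: "(3 \<times> 3 \<times> 3) set \<Rightarrow> bool" where
  "free_triples S \<longleftrightarrow>
     (\<forall>(i, j, k)\<in>S. \<forall>(i', j', k')\<in>S. (i, j, k) \<noteq> (i', j', k') \<longrightarrow>
        i \<noteq> i' \<and> j \<noteq> j' \<or> i \<noteq> i' \<and> k \<noteq> k' \<or> j \<noteq> j' \<and> k \<noteq> k')"

definition free_tensor :: "tensor \<Rightarrow> bool" where
  "free_tensor T \<longleftrightarrow>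
     (\<exists>A B C. invertible A \<and> invertible B \<and> invertible C \<and>
        free_triples (tensor_supp (tensor_act A B C T)))"

definition T2 :: tensor where
  "T2 = tensor_basis 1 2 3 + tensor_basis 1 3 2 + tensor_basis 2 1 3
      + tensor_basis 2 2 1 + tensor_basis 2 2 2 + tensor_basis 3 1 1"

definition T5 :: tensor where
  "T5 = tensor_basis 1 1 3 + tensor_basis 1 3 1 + tensor_basis 1 3 2
      + tensor_basis 2 2 1 + tensor_basis 3 1 2"

end

theory Submission
  imports Defs "HOL-Analysis.Determinants"
begin

text \<open>
  Reversing columns, the slices of both tensors in the third direction form a space of upper
  triangular matrices \<open>U z\<close> with \<open>det (U z) = z\<^sub>1 z\<^sub>2 (z\<^sub>1 + z\<^sub>2)\<close>, in which \<open>U e\<^sub>3\<close> is strictly upper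
  triangular. If the support is free after a change of bases, the new slices \<open>S\<^sub>k = A U(c\<^sub>k) B\<close>, with
  \<open>c\<^sub>k\<close> a basis, have at most one entry per row and column, and disjoint supports.

  If some \<open>S\<^sub>k\<close> is invertible, its quotients \<open>Y\<close>, \<open>Z\<close> with the other two slices have zero diagonal.
  Writing \<open>e\<^sub>3\<close> in the basis \<open>c\<close>, the trace shows that a nonzero combination of \<open>Y\<close> and \<open>Z\<close> alone is
  conjugate, simultaneously with \<open>Y\<close> and \<open>Z\<close>, to a strictly upper triangular matrix. The sparsity
  of \<open>Y\<close> and \<open>Z\<close> together with traces of words in them then forces both to be nilpotent, which
  contradicts the linear independence of the \<open>c\<^sub>k\<close>. If all \<open>S\<^sub>k\<close> are singular, all \<open>c\<^sub>k\<close> lie on the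
  three lines \<open>z\<^sub>1 z\<^sub>2 (z\<^sub>1 + z\<^sub>2) = 0\<close>, and \<open>det (s S\<^sub>k + t S\<^sub>l)\<close> would have two nonzero mixed
  coefficients for two of the slices, which sparsity excludes.
\<close>

section \<open>Sparsity patterns and three-element index sets\<close>

definition partial_monomial :: "complex^'n^'m \<Rightarrow> bool" where
  "partial_monomial X \<longleftrightarrow>
     (\<forall>i j j'. j \<noteq> j' \<longrightarrow> X $ i $ j = 0 \<or> X $ i $ j' = 0) \<and>
     (\<forall>i i' j. i \<noteq> i' \<longrightarrow> X $ i $ j = 0 \<or> X $ i' $ j = 0)"

definition disjoint_support :: "complex^'n^'m \<Rightarrow> complex^'n^'m \<Rightarrow> bool" where
  "disjoint_support X Y \<longleftrightarrow> (\<forall>i j. X $ i $ j = 0 \<or> Y $ i $ j = 0)"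

definition hollow :: "complex^'n^'n \<Rightarrow> bool" where
  "hollow X \<longleftrightarrow> (\<forall>i. X $ i $ i = 0)"

definition upper3 :: "complex^3^3 \<Rightarrow> bool" where
  "upper3 X \<longleftrightarrow> X $ 2 $ 1 = 0 \<and> X $ 3 $ 1 = 0 \<and> X $ 3 $ 2 = 0"

lemma disjoint_support_sym: "disjoint_support X Y \<Longrightarrow> disjoint_support Y X"
  unfolding disjoint_support_def by blast

text \<open>Complex scalars are written \<open>mat c ** M\<close>, so that associativity and
  distributivity of \<open>**\<close> cover them.\<close>

lemma mat_scale: "mat c ** (M :: complex^'n^'n) = (\<chi> i j. c * M $ i $ j)"
  by (simp add: vec_eq_iff matrix_matrix_mult_def mat_def if_distrib if_distribR cong: if_cong)

lemma mat_scale_commute: "M ** mat c = mat c ** (M :: complex^'n^'n)"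
  by (simp add: mat_scale vec_eq_iff matrix_matrix_mult_def mat_def if_distrib if_distribR mult.commute
      cong: if_cong)

lemma partial_monomial_row:
  "partial_monomial X \<Longrightarrow> X $ i $ j \<noteq> 0 \<Longrightarrow> X $ i $ j' \<noteq> 0 \<Longrightarrow> j = j'"
  unfolding partial_monomial_def by blast

lemma partial_monomial_col:
  "partial_monomial X \<Longrightarrow> X $ i $ j \<noteq> 0 \<Longrightarrow> X $ i' $ j \<noteq> 0 \<Longrightarrow> i = i'"
  unfolding partial_monomial_def by blast

lemma exhaust_distinct_3:
  fixes x y z w :: 3
  assumes "x \<noteq> y" "y \<noteq> z" "x \<noteq> z"
  shows "w = x \<or> w = y \<or> w = z"
  using assms exhaust_3[of x] exhaust_3[of y] exhaust_3[of z] exhaust_3[of w] by auto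

lemma ex_third_3: "\<exists>z :: 3. z \<noteq> x \<and> z \<noteq> y"
proof (rule ccontr)
  assume "\<not> ?thesis"
  then have "UNIV = {x, y}"
    by auto
  moreover have "card {x, y} \<le> 2"
    by (simp add: card_insert_if)
  ultimately have "CARD(3) \<le> 2"
    by simp
  then show False
    by simp
qed

lemma UNIV_distinct_3:
  fixes x y z :: 3
  assumes "x \<noteq> y" "y \<noteq> z" "x \<noteq> z"
  shows "UNIV = {x, y, z}"
  using exhaust_distinct_3[OF assms] by auto

lemma sum_distinct_3:
  fixes x y z :: 3
  assumes "x \<noteq> y" "y \<noteq> z" "x \<noteq> z"
  shows "sum f UNIV = f x + f y + f z"
  using assms by (simp add: UNIV_distinct_3[OF assms] add.assoc)

section \<open>Traces and determinants of sparse matrices\<close>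

lemma trace_mult:
  "trace (A ** B) = (\<Sum>i\<in>UNIV. \<Sum>j\<in>UNIV. A $ i $ j * B $ j $ i)"
  by (simp add: trace_def matrix_matrix_mult_def)

lemma trace_mult3:
  fixes A B C :: "complex^'n^'n"
  shows "trace (A ** B ** C) = (\<Sum>i\<in>UNIV. \<Sum>j\<in>UNIV. \<Sum>k\<in>UNIV. A $ i $ j * B $ j $ k * C $ k $ i)"
proof -
  have "trace (A ** B ** C) = trace (A ** (B ** C))"
    by (simp only: matrix_mul_assoc)
  also have "\<dots> = (\<Sum>i\<in>UNIV. \<Sum>j\<in>UNIV. A $ i $ j * (B ** C) $ j $ i)"
    by (rule trace_mult)
  finally show ?thesis
    by (simp add: matrix_matrix_mult_def sum_distrib_left mult.assoc)
qed

text \<open>A nonzero trace gives a closed walk \<open>i\<close>, \<open>j\<close>,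
  \<open>i\<close>. It uses up rows and columns \<open>i\<close> and \<open>j\<close>, and the
  diagonal entry at \<open>k\<close> is zero, so the support of \<open>Y\<close> is symmetric. Hence
  \<open>Z $ a $ b\<close> vanishes wherever \<open>Y $ b $ a\<close> does not.\<close>

lemma hollow_trace_square:
  fixes Y Z :: "complex^3^3"
  assumes Y: "partial_monomial Y" "hollow Y" and Z: "disjoint_support Y Z"
    and nz: "trace (Y ** Y) \<noteq> 0"
  shows "trace (Z ** Y) = 0"
proof -
  obtain i j where ij: "Y $ i $ j \<noteq> 0" "Y $ j $ i \<noteq> 0"
    using nz unfolding trace_mult by (metis (mono_tags, lifting) mult_eq_0_iff sum.neutral)
  then have "i \<noteq> j"
    using Y(2) unfolding hollow_def by auto
  then obtain k where k: "k \<noteq> i" "k \<noteq> j"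
    using ex_third_3 by metis
  have "Z $ a $ b * Y $ b $ a = 0" for a b
  proof (rule ccontr)
    assume "\<not> ?thesis"
    then have ab: "Z $ a $ b \<noteq> 0" "Y $ b $ a \<noteq> 0"
      by auto
    then have "b = i \<and> a = j \<or> b = j \<and> a = i"
      using ij \<open>i \<noteq> j\<close> k Y exhaust_distinct_3[of i j k a] exhaust_distinct_3[of i j k b]
        partial_monomial_row[OF Y(1)] partial_monomial_col[OF Y(1)]
      unfolding hollow_def by metis
    then show False
      using ab ij Z unfolding disjoint_support_def by metis
  qed
  then show ?thesis
    unfolding trace_mult by (simp only: sum.neutral_const)
qed

text \<open>A nonzero trace makes the support of \<open>Y\<close> a 3-cycle. Two steps
  \<open>b\<close>, \<open>c\<close>, \<open>a\<close> along it leave \<open>(a, b)\<close> as the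
  closing step, a place where \<open>Z\<close> vanishes.\<close>

lemma hollow_trace_cube:
  fixes Y Z :: "complex^3^3"
  assumes Y: "partial_monomial Y" "hollow Y" and Z: "disjoint_support Y Z"
    and nz: "trace (Y ** Y ** Y) \<noteq> 0"
  shows "trace (Z ** Y ** Y) = 0"
proof -
  obtain i j k where ij: "Y $ i $ j \<noteq> 0" "Y $ j $ k \<noteq> 0" "Y $ k $ i \<noteq> 0"
    using nz unfolding trace_mult3 by (metis (mono_tags, lifting) mult_eq_0_iff sum.neutral)
  then have d: "i \<noteq> j" "j \<noteq> k" "i \<noteq> k"
    using Y(2) unfolding hollow_def by auto
  have "Z $ a $ b * Y $ b $ c * Y $ c $ a = 0" for a b c
  proof (rule ccontr)
    assume "\<not> ?thesis"
    then have ab: "Z $ a $ b \<noteq> 0" "Y $ b $ c \<noteq> 0" "Y $ c $ a \<noteq> 0"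
      by auto
    then have "Y $ a $ b \<noteq> 0"
      using ij exhaust_distinct_3[OF d, of b] partial_monomial_row[OF Y(1)] by metis
    then show False
      using ab Z unfolding disjoint_support_def by metis
  qed
  then show ?thesis
    unfolding trace_mult3 by (simp only: sum.neutral_const)
qed

text \<open>The hypotheses on \<open>Z\<close> reduce it to a path \<open>i\<close>,
  \<open>j\<close>, \<open>k\<close>; the mixed traces then remove every entry of \<open>Y\<close>
  except \<open>Y $ i $ k\<close>.\<close>

lemma regular_nilpotent_companion:
  fixes Y Z :: "complex^3^3"
  assumes Y: "partial_monomial Y" "hollow Y" and Z: "partial_monomial Z" "hollow Z"
    and YZ: "disjoint_support Y Z"
    and "Z ** Z \<noteq> 0" "trace (Z ** Z) = 0" "trace (Z ** Z ** Z) = 0"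
    and "trace (Z ** Y) = 0" "trace (Z ** Z ** Y) = 0" "trace ((Z ** Y) ** (Z ** Y)) = 0"
  shows "trace (Y ** Y) = 0 \<and> trace (Y ** Y ** Y) = 0"
proof -
  obtain i k where "(Z ** Z) $ i $ k \<noteq> 0"
    using assms(6) by (auto simp: vec_eq_iff)
  then obtain j where j: "Z $ i $ j \<noteq> 0" "Z $ j $ k \<noteq> 0"
    unfolding matrix_matrix_mult_def
    by simp (metis (mono_tags, lifting) mult_eq_0_iff sum.neutral)
  have hz: "Z $ a $ a = 0" "Y $ a $ a = 0" for a
    using Y Z unfolding hollow_def by auto
  have d1: "i \<noteq> j" "j \<noteq> k"
    using hz j by auto
  \<comment> \<open>Otherwise the two entries use up rows and columns \<open>i\<close> and
    \<open>j\<close>, and the trace of \<open>Z ** Z\<close> is twice their product.\<close>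
  have "k \<noteq> i"
  proof
    assume [simp]: "k = i"
    obtain l where l: "l \<noteq> i" "l \<noteq> j"
      using ex_third_3 by metis
    have z: "Z $ i $ l = 0" "Z $ j $ l = 0" "Z $ l $ i = 0" "Z $ l $ j = 0"
      using Z(1) j l unfolding partial_monomial_def by (metis \<open>k = i\<close>)+
    show False
      using j assms(7) by (simp add: trace_mult sum_distinct_3[of i j l] d1 l l[symmetric] hz z)
  qed
  then have d: "i \<noteq> j" "j \<noteq> k" "i \<noteq> k"
    using d1 by auto
  note sums = trace_def matrix_matrix_mult_def sum_distinct_3[OF d] vec_lambda_beta
  have z: "Z $ i $ k = 0" "Z $ j $ i = 0" "Z $ k $ j = 0" "Y $ i $ j = 0" "Y $ j $ k = 0"
    using Z(1) YZ j d unfolding partial_monomial_def disjoint_support_def by metis+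
  \<comment> \<open>The factor 3 counts the starting points of the closed walk.\<close>
  have "3 * (Z $ i $ j * Z $ j $ k * Z $ k $ i) = 0"
    using assms(8) by (simp only: sums) (simp add: hz z mult_ac)
  then have z2: "Z $ k $ i = 0"
    using j by simp
  have z3: "Y $ k $ i = 0"
    using assms(10) j by (simp only: sums) (simp add: hz z z2)
  \<comment> \<open>Two numbers with zero sum and zero sum of squares both vanish.\<close>
  have "Z $ i $ j * Y $ j $ i + Z $ j $ k * Y $ k $ j = 0"
    using assms(9) by (simp only: sums) (simp add: hz z z2)
  moreover have "(Z $ i $ j * Y $ j $ i)\<^sup>2 + (Z $ j $ k * Y $ k $ j)\<^sup>2 = 0"
    using assms(11) by (simp only: sums) (simp add: hz z z2 z3 power2_eq_square)
  ultimately have "Z $ i $ j * Y $ j $ i = 0 \<and> Z $ j $ k * Y $ k $ j = 0"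
    by (auto simp: add_eq_0_iff2)
  then have "Y $ j $ i = 0" "Y $ k $ j = 0"
    using j by auto
  then show ?thesis
    by (simp only: sums) (simp add: hz z z3)
qed

text \<open>Column \<open>j\<close> of the first relation and row \<open>i\<close> of the second
  make \<open>Y\<close> strictly triangular in the index order \<open>i\<close>, \<open>k\<close>,
  \<open>j\<close>.\<close>

lemma square_zero_companion:
  fixes Y Z :: "complex^3^3"
  assumes Y: "hollow Y" and Z: "partial_monomial Z" "hollow Z"
    and "Z \<noteq> 0" and YZ: "Y ** Z = mat a ** Z" and ZY: "Z ** Y = mat b ** Z"
  shows "trace (Y ** Y) = 0 \<and> trace (Y ** Y ** Y) = 0"
proof -
  obtain i j where ij: "Z $ i $ j \<noteq> 0"
    using assms(4) by (auto simp: vec_eq_iff)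
  have hz: "Z $ a $ a = 0" "Y $ a $ a = 0" for a
    using Y Z unfolding hollow_def by auto
  have "i \<noteq> j"
    using ij hz by auto
  then obtain k where d: "i \<noteq> j" "j \<noteq> k" "i \<noteq> k"
    using ex_third_3 by metis
  have z: "Z $ i $ k = 0" "Z $ j $ j = 0" "Z $ k $ j = 0"
    using Z(1) ij d hz unfolding partial_monomial_def by metis+
  have "(Y ** Z) $ c $ j = a * Z $ c $ j" "(Z ** Y) $ i $ c = b * Z $ i $ c" for c
    by (simp_all add: YZ ZY mat_scale)
  note this[of i] this[of j] this[of k]
  then have "Y $ j $ i = 0" "Y $ k $ i = 0" "Y $ j $ k = 0"
    using ij by (simp_all add: matrix_matrix_mult_def sum_distinct_3[OF d] hz z)
  then show ?thesis
    by (simp only: trace_def matrix_matrix_mult_def vec_lambda_beta sum_distinct_3[OF d]) (simp add: hz)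
qed

text \<open>A nonzero mixed coefficient of \<open>det (s X + t Y)\<close> in \<open>s\<^sup>2 t\<close> comes from a permutation
  with two entries in \<open>X\<close> and one in \<open>Y\<close>; then these two are all of \<open>X\<close>, and no permutation can
  use just one of them together with two entries of \<open>Y\<close>.\<close>

lemma det_add_diff_squares:
  fixes X Y :: "complex^3^3"
  assumes X: "partial_monomial X" "det X = 0"
    and Y: "partial_monomial Y" "det Y = 0"
    and XY: "disjoint_support X Y"
  shows "(det (X + Y))\<^sup>2 = (det (X - Y))\<^sup>2"
proof -
  \<comment> \<open>The determinant with rows 1, 2, 3 taken from \<open>A\<close>, \<open>B\<close>,
    \<open>C\<close>. Thus \<open>k1\<close> and \<open>k2\<close> below are the coefficients of
    \<open>s^2 t\<close> and \<open>s t^2\<close> in \<open>det (s X + t Y)\<close>.\<close>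
  define p :: "complex^3^3 \<Rightarrow> complex^3^3 \<Rightarrow> complex^3^3 \<Rightarrow> complex" where "p = (\<lambda>A B C.
      A$1$1 * B$2$2 * C$3$3 + A$1$2 * B$2$3 * C$3$1 + A$1$3 * B$2$1 * C$3$2
      - A$1$1 * B$2$3 * C$3$2 - A$1$2 * B$2$1 * C$3$3 - A$1$3 * B$2$2 * C$3$1)"
  define k1 where "k1 = p X X Y + p X Y X + p Y X X"
  define k2 where "k2 = p Y Y X + p Y X Y + p X Y Y"
  have p: "\<exists>i j k. i \<noteq> j \<and> j \<noteq> k \<and> i \<noteq> k \<and> A$1$i \<noteq> 0 \<and> B$2$j \<noteq> 0 \<and> C$3$k \<noteq> 0" if "p A B C \<noteq> 0" for A B C
  proof -
    have d: "(1::3) \<noteq> 2" "(2::3) \<noteq> 3" "(1::3) \<noteq> 3"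
      by simp_all
    have "A$1$1 * B$2$2 * C$3$3 \<noteq> 0 \<or> A$1$2 * B$2$3 * C$3$1 \<noteq> 0 \<or> A$1$3 * B$2$1 * C$3$2 \<noteq> 0 \<or>
      A$1$1 * B$2$3 * C$3$2 \<noteq> 0 \<or> A$1$2 * B$2$1 * C$3$3 \<noteq> 0 \<or> A$1$3 * B$2$2 * C$3$1 \<noteq> 0"
      using that unfolding p_def by (rule contrapos_np) (simp only: de_Morgan_disj not_not, simp)
    then show ?thesis
      unfolding mult_eq_0_iff de_Morgan_disj using d d[symmetric] by (elim disjE) blast+
  qed
  have perm: "\<exists>r1 r2 r3 c1 c2 c3. r1 \<noteq> r2 \<and> r2 \<noteq> r3 \<and> r1 \<noteq> r3 \<and> c1 \<noteq> c2 \<and> c2 \<noteq> c3 \<and> c1 \<noteq> c3 \<and>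
      A $ r1 $ c1 \<noteq> 0 \<and> A $ r2 $ c2 \<noteq> 0 \<and> B $ r3 $ c3 \<noteq> 0"
    if nz: "p A A B + p A B A + p B A A \<noteq> 0" for A B
  proof -
    have d: "(1::3) \<noteq> 2" "(2::3) \<noteq> 3" "(1::3) \<noteq> 3"
      by simp_all
    consider "p A A B \<noteq> 0" | "p A B A \<noteq> 0" | "p B A A \<noteq> 0"
      using nz by fastforce
    then show ?thesis
    proof cases
      case 1
      show ?thesis
        using p[OF 1] d by blast
    next
      case 2
      then obtain i j k where "i \<noteq> j" "j \<noteq> k" "i \<noteq> k" "A$1$i \<noteq> 0" "B$2$j \<noteq> 0" "A$3$k \<noteq> 0"
        using p by blast
      then show ?thesis
        using d by (intro exI[of _ 1] exI[of _ 3] exI[of _ 2] exI[of _ i] exI[of _ k] exI[of _ j]) simp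
    next
      case 3
      then obtain i j k where "i \<noteq> j" "j \<noteq> k" "i \<noteq> k" "B$1$i \<noteq> 0" "A$2$j \<noteq> 0" "A$3$k \<noteq> 0"
        using p by blast
      then show ?thesis
        using d by (intro exI[of _ 2] exI[of _ 3] exI[of _ 1] exI[of _ j] exI[of _ k] exI[of _ i]) simp
    qed
  qed
  have "k2 = 0" if "k1 \<noteq> 0"
  proof (rule ccontr)
    assume "k2 \<noteq> 0"
    obtain r1 r2 r3 c1 c2 c3 where r: "r1 \<noteq> r2" "r2 \<noteq> r3" "r1 \<noteq> r3"
      and c: "c1 \<noteq> c2" "c2 \<noteq> c3" "c1 \<noteq> c3"
      and rc: "X $ r1 $ c1 \<noteq> 0" "X $ r2 $ c2 \<noteq> 0" "Y $ r3 $ c3 \<noteq> 0"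
      using perm[OF \<open>k1 \<noteq> 0\<close>[unfolded k1_def]] by (elim exE conjE) (rule that)
    obtain s1 s2 s3 d1 d2 d3 where s: "s1 \<noteq> s2" "s2 \<noteq> s3" "s1 \<noteq> s3"
      and d: "d1 \<noteq> d2" "d2 \<noteq> d3" "d1 \<noteq> d3"
      and sd: "Y $ s1 $ d1 \<noteq> 0" "Y $ s2 $ d2 \<noteq> 0" "X $ s3 $ d3 \<noteq> 0"
      using perm[OF \<open>k2 \<noteq> 0\<close>[unfolded k2_def]] by (elim exE conjE) (rule that)
    have disj: "X $ a $ b = 0 \<or> Y $ a $ b = 0" for a b
      using XY unfolding disjoint_support_def by blast
    have "s3 = r1 \<and> d3 = c1 \<or> s3 = r2 \<and> d3 = c2"
      using exhaust_distinct_3[OF r, of s3] exhaust_distinct_3[OF c, of d3]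
        partial_monomial_row[OF X(1)] partial_monomial_col[OF X(1)] rc sd(3) disj by metis
    \<comment> \<open>The two \<open>Y\<close> entries of the second permutation occupy rows
      \<open>r'\<close>, \<open>r3\<close> and columns \<open>c'\<close>, \<open>c3\<close>. The one
      in row \<open>r3\<close> must sit in column \<open>c3\<close>, so the other sits at
      \<open>(r', c')\<close>, which belongs to \<open>X\<close>.\<close>
    moreover have ex: False if "s3 = r" "d3 = c" "r \<noteq> r'" "r' \<noteq> r3" "r \<noteq> r3" "c \<noteq> c'" "c' \<noteq> c3"
      "c \<noteq> c3" "X $ r' $ c' \<noteq> 0" for r r' c c'
    proof -
      have "s1 = r' \<and> s2 = r3 \<or> s1 = r3 \<and> s2 = r'"
        using exhaust_distinct_3[of r r' r3 s1] exhaust_distinct_3[of r r' r3 s2] s that by metis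
      moreover have "d1 = c' \<and> d2 = c3 \<or> d1 = c3 \<and> d2 = c'"
        using exhaust_distinct_3[of c c' c3 d1] exhaust_distinct_3[of c c' c3 d2] d that by metis
      ultimately have "Y $ r' $ c' \<noteq> 0"
        using sd rc that partial_monomial_row[OF Y(1)] by metis
      then show False
        using disj that by blast
    qed
    ultimately show False
      using r c rc ex[of r1 c1 r2 c2] ex[of r2 c2 r1 c1] by metis
  qed
  \<comment> \<open>As \<open>det X\<close> and \<open>det Y\<close> vanish, the two squares differ
    by \<open>4 * k1 * k2\<close>.\<close>
  moreover have "det (X + Y) = det X + k1 + k2 + det Y" "det (X - Y) = det X - k1 + k2 - det Y"
    unfolding k1_def k2_def p_def det_3 by (simp_all add: algebra_simps)
  ultimately show ?thesis
    using X(2) Y(2) by (cases "k1 = 0") (auto simp: power2_eq_square)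
qed

section \<open>Quotients by an invertible sparse matrix\<close>

lemma partial_monomial_quotient:
  fixes X G :: "complex^'n^'n"
  assumes X: "partial_monomial X" and XG: "X ** G = mat 1" and GX: "G ** X = mat 1"
  obtains t where "inj t" "\<And>j. X $ t j $ j \<noteq> 0"
    "\<And>(Y :: complex^'n^'n) j k. (G ** Y) $ j $ k = Y $ t j $ k / X $ t j $ j"
proof -
  have "\<exists>i. X $ i $ j \<noteq> 0" for j
  proof (rule ccontr)
    assume "\<not> ?thesis"
    then have "(G ** X) $ j $ j = 0"
      by (simp add: matrix_matrix_mult_def)
    then show False
      by (simp add: GX mat_def)
  qed
  then obtain t where t: "\<And>j. X $ t j $ j \<noteq> 0"
    by metis
  have "inj t"
    using t X unfolding partial_monomial_def inj_def by metis
  moreover have "(G ** Y) $ j $ k = Y $ t j $ k / X $ t j $ j" for Y :: "complex^'n^'n" and j k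
  proof -
    have z: "X $ t j $ l = 0" if "l \<noteq> j" for l
      using t X that unfolding partial_monomial_def by metis
    have "Y $ t j $ k = (X ** (G ** Y)) $ t j $ k"
      by (simp add: matrix_mul_assoc XG)
    also have "\<dots> = (\<Sum>l\<in>UNIV. X $ t j $ l * (G ** Y) $ l $ k)"
      by (simp add: matrix_matrix_mult_def)
    also have "\<dots> = (\<Sum>l\<in>{j}. X $ t j $ l * (G ** Y) $ l $ k)"
      by (rule sum.mono_neutral_right) (auto simp: z)
    finally show ?thesis
      using t by simp
  qed
  ultimately show ?thesis
    using that t by blast
qed

text \<open>An invertible partial monomial matrix is a permutation matrix with rescaled entries, so
  \<open>G\<close> only permutes and rescales rows. This moves the support of \<open>X\<close> onto
  the diagonal, whence disjointness from \<open>X\<close> turns into hollowness.\<close>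

lemma
  fixes X Y Z G :: "complex^'n^'n"
  assumes "partial_monomial X" "X ** G = mat 1" "G ** X = mat 1"
  shows partial_monomial_inverse_mult: "partial_monomial Y \<Longrightarrow> partial_monomial (G ** Y)"
    and disjoint_support_inverse_mult: "disjoint_support Y Z \<Longrightarrow> disjoint_support (G ** Y) (G ** Z)"
    and hollow_inverse_mult: "disjoint_support X Y \<Longrightarrow> hollow (G ** Y)"
proof -
  obtain t where t: "inj t" "\<And>j. X $ t j $ j \<noteq> 0"
    "\<And>(Y :: complex^'n^'n) j k. (G ** Y) $ j $ k = Y $ t j $ k / X $ t j $ j"
    by (rule partial_monomial_quotient[OF assms]) (rule that)
  show "partial_monomial Y \<Longrightarrow> partial_monomial (G ** Y)"
    using inj_eq[OF t(1)] unfolding partial_monomial_def by (simp add: t(2,3))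
  show "disjoint_support Y Z \<Longrightarrow> disjoint_support (G ** Y) (G ** Z)"
    unfolding disjoint_support_def by (simp add: t(2,3))
  show "disjoint_support X Y \<Longrightarrow> hollow (G ** Y)"
    using t(2) unfolding disjoint_support_def hollow_def t(3) by simp blast
qed

section \<open>Conjugation and upper triangular matrices\<close>

lemma trace_conjugate:
  fixes H H' W :: "complex^'n^'n"
  assumes "H ** H' = mat 1"
  shows "trace (H' ** W ** H) = trace W"
proof -
  have "trace (H' ** W ** H) = trace (H ** (H' ** W))"
    by (rule trace_mul_sym)
  then show ?thesis
    by (simp add: matrix_mul_assoc assms)
qed

lemma conjugate_mult:
  fixes H H' V W :: "complex^'n^'n"
  assumes "H ** H' = mat 1"
  shows "(H' ** V ** H) ** (H' ** W ** H) = H' ** (V ** W) ** H"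
proof -
  have "(H' ** V ** H) ** (H' ** W ** H) = H' ** V ** (H ** H') ** W ** H"
    by (simp only: matrix_mul_assoc)
  then show ?thesis
    by (simp add: assms matrix_mul_assoc)
qed

lemma conjugate_mat_scale:
  fixes H H' W :: "complex^'n^'n"
  shows "H' ** (mat c ** W) ** H = mat c ** (H' ** W ** H)"
  by (metis mat_scale_commute matrix_mul_assoc)

lemma upper3_mult: "upper3 V \<Longrightarrow> upper3 W \<Longrightarrow> upper3 (V ** W)"
  unfolding upper3_def by (simp add: matrix_matrix_mult_def sum_3)

lemma upper3_mult_diag: "upper3 V \<Longrightarrow> upper3 W \<Longrightarrow> (V ** W) $ i $ i = V $ i $ i * W $ i $ i"
  using exhaust_3[of i] unfolding upper3_def by (auto simp: matrix_matrix_mult_def sum_3)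

lemma det_upper3: "upper3 W \<Longrightarrow> det W = W$1$1 * W$2$2 * W$3$3"
  unfolding upper3_def by (simp add: det_3)

text \<open>Back substitution, starting from the last row.\<close>

lemma upper3_left_cancel:
  assumes "upper3 U" "det U \<noteq> 0" "upper3 (U ** W)"
  shows "upper3 W"
proof -
  have nz: "U $ 1 $ 1 \<noteq> 0" "U $ 2 $ 2 \<noteq> 0" "U $ 3 $ 3 \<noteq> 0"
    using assms(2) by (simp_all add: det_upper3[OF assms(1)])
  have "W $ 3 $ 1 = 0" "W $ 3 $ 2 = 0"
    using assms nz unfolding upper3_def by (simp_all add: matrix_matrix_mult_def sum_3)
  moreover from this have "W $ 2 $ 1 = 0"
    using assms nz unfolding upper3_def by (simp_all add: matrix_matrix_mult_def sum_3)
  ultimately show ?thesis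
    unfolding upper3_def by blast
qed

text \<open>With zero sum, the sum of cubes is \<open>3 * a * b * c\<close>, so one of the numbers
  vanishes; the squares settle the other two.\<close>

lemma power_sums_eq_0:
  fixes a b c :: complex
  assumes "a + b + c = 0" "a\<^sup>2 + b\<^sup>2 + c\<^sup>2 = 0" "a^3 + b^3 + c^3 = 0"
  shows "a = 0 \<and> b = 0 \<and> c = 0"
proof -
  have c: "c = - (a + b)"
    using assms(1) eq_neg_iff_add_eq_0[of c "a + b"] by (simp add: add.commute)
  have "a^3 + b^3 + c^3 = - 3 * (a * b * (a + b))"
    unfolding c by (simp add: power3_eq_cube algebra_simps)
  then have "a * b * (a + b) = 0"
    using assms(3) by simp
  then consider "a = 0" | "b = 0" | "a + b = 0"
    by auto
  then show ?thesis
  proof cases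
    case 1
    then show ?thesis using assms(2) c by simp
  next
    case 2
    then show ?thesis using assms(2) c by simp
  next
    case 3
    then have "b = - a" by (simp add: eq_neg_iff_add_eq_0 add.commute)
    then show ?thesis using assms(2) c by simp
  qed
qed

text \<open>Traces of powers are power sums of the diagonal. They are conjugation invariant, so they
  can be computed on the sparse side.\<close>

lemma upper3_nilpotent_hollow:
  assumes "upper3 W" "trace W = 0" "trace (W ** W) = 0" "trace (W ** W ** W) = 0"
  shows "hollow W"
proof -
  have "W$1$1 + W$2$2 + W$3$3 = 0" "(W$1$1)\<^sup>2 + (W$2$2)\<^sup>2 + (W$3$3)\<^sup>2 = 0"
    "(W$1$1)^3 + (W$2$2)^3 + (W$3$3)^3 = 0"
    using assms(2-4)
    by (simp_all add: trace_def upper3_mult_diag assms(1) upper3_mult sum_3 power2_eq_square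
        power3_eq_cube)
  from power_sums_eq_0[OF this] show ?thesis
    by (simp add: hollow_def forall_3)
qed

section \<open>Nilpotent members of a triangular pencil\<close>

lemma hollow_trace: "hollow W \<Longrightarrow> trace W = 0"
  by (simp add: hollow_def trace_def)

text \<open>The matrix \<open>U e\<^sub>3\<close> is of the first kind (a regular nilpotent) for \<open>T2\<close>, and of the second
  (a multiple of the corner matrix unit) for \<open>T5\<close>.\<close>

definition regular_or_corner :: "complex^3^3 \<Rightarrow> bool" where
  "regular_or_corner W \<longleftrightarrow> upper3 W \<and> hollow W \<and>
     (W$1$2 \<noteq> 0 \<and> W$2$3 \<noteq> 0 \<or> W$1$2 = 0 \<and> W$2$3 = 0 \<and> W$1$3 \<noteq> 0)"

lemma regular_or_corner_scale:
  "c \<noteq> 0 \<Longrightarrow> regular_or_corner (mat c ** W) \<longleftrightarrow> regular_or_corner W"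
  by (simp add: regular_or_corner_def upper3_def hollow_def mat_scale)

text \<open>\<open>U\<close> rescales the superdiagonal entries of \<open>W\<close> by nonzero
  factors. The extra term in the corner is a multiple of \<open>W $ 2 $ 3\<close>, which is zero in
  the corner case.\<close>

lemma regular_or_corner_left_cancel:
  assumes U: "upper3 U" "det U \<noteq> 0" and UW: "regular_or_corner (U ** W)"
  shows "regular_or_corner W"
proof -
  have nz: "U $ 1 $ 1 \<noteq> 0" "U $ 2 $ 2 \<noteq> 0" "U $ 3 $ 3 \<noteq> 0"
    using U by (simp_all add: det_upper3)
  have W: "upper3 W"
    using upper3_left_cancel U UW unfolding regular_or_corner_def by blast
  have h: "W $ i $ i = 0" for i
    using UW upper3_mult_diag[OF U(1) W, of i] nz exhaust_3[of i]
    unfolding regular_or_corner_def hollow_def by auto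
  have "(U ** W) $ 1 $ 2 = U$1$1 * W$1$2" "(U ** W) $ 2 $ 3 = U$2$2 * W$2$3"
    "(U ** W) $ 1 $ 3 = U$1$1 * W$1$3 + U$1$2 * W$2$3"
    using W U h unfolding upper3_def by (simp_all add: matrix_matrix_mult_def sum_3)
  then show ?thesis
    using UW nz W h unfolding regular_or_corner_def hollow_def by auto
qed

text \<open>The two kinds of \<open>W\<close> supply the hypotheses of the two companion lemmas: a
  regular \<open>W\<close> has nonzero square, and a corner \<open>W\<close> is an eigenvector of
  left and right multiplication by \<open>V\<close>.\<close>

lemma hollow_companion:
  fixes V W H H' :: "complex^3^3"
  assumes HH: "H ** H' = mat 1" "H' ** H = mat 1"
    and Y: "partial_monomial (H' ** V ** H)" "hollow (H' ** V ** H)"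
    and Z: "partial_monomial (H' ** W ** H)" "hollow (H' ** W ** H)"
    and YZ: "disjoint_support (H' ** V ** H) (H' ** W ** H)"
    and V: "upper3 V" and W: "regular_or_corner W"
  shows "hollow V"
proof -
  let ?Y = "H' ** V ** H" and ?Z = "H' ** W ** H"
  note simps = conjugate_mult[OF HH(1)] trace_conjugate[OF HH(1)]
  have inj: "A = B" if "H' ** A ** H = H' ** B ** H" for A B :: "complex^3^3"
  proof -
    have "H ** (H' ** A ** H) ** H' = H ** (H' ** B ** H) ** H'"
      using that by simp
    moreover have "H ** (H' ** C ** H) ** H' = C" for C
    proof -
      have "H ** (H' ** C ** H) ** H' = (H ** H') ** C ** (H ** H')"
        by (simp only: matrix_mul_assoc)
      then show ?thesis
        by (simp add: HH)
    qed
    ultimately show ?thesis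
      by simp
  qed
  have W': "upper3 W" "\<And>i. W $ i $ i = 0"
    using W unfolding regular_or_corner_def hollow_def by auto
  have "trace (?Y ** ?Y) = 0 \<and> trace (?Y ** ?Y ** ?Y) = 0"
  proof (cases "W$1$2 = 0")
    case False
    then have "(W ** W) $ 1 $ 3 \<noteq> 0"
      using W W' unfolding regular_or_corner_def upper3_def
      by (simp add: matrix_matrix_mult_def sum_3)
    then have "?Z ** ?Z \<noteq> 0"
      using inj[of "W ** W" 0] by (auto simp: simps)
    \<comment> \<open>Each word is conjugate to a triangular product with a factor \<open>W\<close>,
      hence has zero diagonal there.\<close>
    moreover have "trace (?Z ** ?Z) = 0" "trace (?Z ** ?Z ** ?Z) = 0" "trace (?Z ** ?Y) = 0"
      "trace (?Z ** ?Z ** ?Y) = 0" "trace ((?Z ** ?Y) ** (?Z ** ?Y)) = 0"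
      by (simp_all only: simps)
        (simp_all add: trace_def upper3_mult_diag upper3_mult V W')
    ultimately show ?thesis
      using regular_nilpotent_companion[OF Y Z YZ] by blast
  next
    case True
    then have c: "W$1$2 = 0" "W$2$3 = 0" "W$1$3 \<noteq> 0"
      using W unfolding regular_or_corner_def by auto
    have "V ** W = mat (V$1$1) ** W" "W ** V = mat (V$3$3) ** W"
      using V W' c unfolding upper3_def
      by (simp_all add: vec_eq_iff forall_3 matrix_matrix_mult_def mat_def sum_3)
    then have "?Y ** ?Z = mat (V$1$1) ** ?Z" "?Z ** ?Y = mat (V$3$3) ** ?Z"
      by (simp_all add: simps conjugate_mat_scale)
    moreover have "?Z \<noteq> 0"
      using inj[of W 0] c by auto
    ultimately show ?thesis
      using square_zero_companion[OF Y(2) Z] by blast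
  qed
  then show ?thesis
    using upper3_nilpotent_hollow[OF V] hollow_trace[OF Y(2)] by (simp add: simps)
qed

text \<open>The diagonal of \<open>V\<close> is \<open>- (b / a)\<close> times that of
  \<open>W\<close>, so replacing one \<open>V\<close> by \<open>W\<close> in a power of
  \<open>V\<close> changes the trace only by this factor. Sparsity forbids both traces to be
  nonzero.\<close>

lemma hollow_of_hollow_combination:
  fixes V W H H' :: "complex^3^3"
  assumes HH: "H ** H' = mat 1"
    and Y: "partial_monomial (H' ** V ** H)" "hollow (H' ** V ** H)"
    and YZ: "disjoint_support (H' ** V ** H) (H' ** W ** H)"
    and V: "upper3 V" and W: "upper3 W"
    and ab: "hollow (mat a ** V + mat b ** W)" "a \<noteq> 0"
  shows "hollow V"
proof -
  let ?Y = "H' ** V ** H" and ?Z = "H' ** W ** H"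
  note simps = conjugate_mult[OF HH(1)] trace_conjugate[OF HH(1)]
  have "a * V $ i $ i = - (b * W $ i $ i)" for i
    using ab(1) by (simp add: hollow_def mat_scale eq_neg_iff_add_eq_0)
  then have d: "V $ i $ i = - (b / a) * W $ i $ i" for i
    using ab(2) by (simp add: field_simps)
  have "trace (V ** V) = - (b / a) * trace (W ** V)"
    by (simp add: trace_def upper3_mult_diag V W sum_distrib_left d algebra_simps)
  then have 2: "trace (?Y ** ?Y) = - (b / a) * trace (?Z ** ?Y)"
    by (simp add: simps)
  have "trace (V ** V ** V) = - (b / a) * trace (W ** V ** V)"
    by (simp add: trace_def upper3_mult_diag upper3_mult V W sum_distrib_left d algebra_simps)
  then have 3: "trace (?Y ** ?Y ** ?Y) = - (b / a) * trace (?Z ** ?Y ** ?Y)"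
    by (simp add: simps)
  have "trace (?Y ** ?Y) = 0" "trace (?Y ** ?Y ** ?Y) = 0"
    using 2 3 hollow_trace_square[OF Y YZ] hollow_trace_cube[OF Y YZ] by fastforce+
  then show ?thesis
    using upper3_nilpotent_hollow[OF V] hollow_trace[OF Y(2)] by (simp add: simps)
qed

text \<open>A nonzero coefficient makes its own matrix hollow. If only one is nonzero, that matrix
  is itself \<open>regular_or_corner\<close> and controls the other.\<close>

lemma hollow_pencil:
  fixes V W H H' :: "complex^3^3"
  assumes HH: "H ** H' = mat 1" "H' ** H = mat 1"
    and Y: "partial_monomial (H' ** V ** H)" "hollow (H' ** V ** H)"
    and Z: "partial_monomial (H' ** W ** H)" "hollow (H' ** W ** H)"
    and YZ: "disjoint_support (H' ** V ** H) (H' ** W ** H)"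
    and V: "upper3 V" and W: "upper3 W"
    and ab: "regular_or_corner (mat a ** V + mat b ** W)"
  shows "hollow V \<and> hollow W"
proof -
  have ZY: "disjoint_support (H' ** W ** H) (H' ** V ** H)"
    using YZ by (rule disjoint_support_sym)
  have hV: "hollow V" if "a \<noteq> 0"
    using hollow_of_hollow_combination[OF HH(1) Y YZ V W _ that] ab
    unfolding regular_or_corner_def by blast
  have hW: "hollow W" if "b \<noteq> 0"
    using hollow_of_hollow_combination[OF HH(1) Z ZY W V, of b a] that ab
    unfolding regular_or_corner_def by (simp add: add.commute)
  have z: "mat 0 ** X = 0" for X :: "complex^3^3"
    by (simp add: mat_scale vec_eq_iff)
  consider "a \<noteq> 0" "b \<noteq> 0" | "a \<noteq> 0" "b = 0" | "a = 0" "b \<noteq> 0" | "a = 0" "b = 0"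
    by blast
  then show ?thesis
  proof cases
    case 1
    then show ?thesis using hV hW by blast
  next
    case 2
    then have "regular_or_corner V"
      using ab by (simp add: z regular_or_corner_scale)
    then show ?thesis
      using hollow_companion[OF HH Z Y ZY W] hV 2 by blast
  next
    case 3
    then have "regular_or_corner W"
      using ab by (simp add: z regular_or_corner_scale)
    then show ?thesis
      using hollow_companion[OF HH Y Z YZ V] hW 3 by blast
  next
    case 4
    then show ?thesis
      using ab by (simp add: z regular_or_corner_def)
  qed
qed

lemma hollow_of_invertible_slice:
  fixes A B U1 U2 U3 :: "complex^3^3"
  assumes AB: "invertible A" "invertible B"
    and S: "partial_monomial (A ** U1 ** B)" "partial_monomial (A ** U2 ** B)"
      "partial_monomial (A ** U3 ** B)"
    and D: "disjoint_support (A ** U1 ** B) (A ** U2 ** B)"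
      "disjoint_support (A ** U1 ** B) (A ** U3 ** B)"
      "disjoint_support (A ** U2 ** B) (A ** U3 ** B)"
    and U: "upper3 U1" "upper3 U2" "upper3 U3" and nz: "det U1 \<noteq> 0"
    and E: "regular_or_corner (mat v1 ** U1 + mat v2 ** U2 + mat v3 ** U3)"
  shows "hollow U2 \<and> hollow U3"
proof -
  obtain A' where A': "A' ** A = mat 1" "A ** A' = mat 1"
    using AB unfolding invertible_def by blast
  obtain B' where B': "B' ** B = mat 1" "B ** B' = mat 1"
    using AB unfolding invertible_def by blast
  obtain U' where U': "U' ** U1 = mat 1" "U1 ** U' = mat 1"
    using nz unfolding invertible_det_nz[symmetric] invertible_def by blast
  \<comment> \<open>\<open>G\<close> inverts the first slice. In \<open>G ** (A ** M ** B)\<close>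
    the factor \<open>A\<close> cancels, leaving simultaneous conjugates by \<open>B\<close> of
    triangular quotients.\<close>
  define G where "G = B' ** U' ** A'"
  define V where "V = U' ** U2"
  define W where "W = U' ** U3"
  have "(A ** U1 ** B) ** G = A ** U1 ** (B ** B') ** U' ** A'"
    unfolding G_def by (simp only: matrix_mul_assoc)
  also have "\<dots> = A ** (U1 ** U') ** A'"
    by (simp add: B' matrix_mul_assoc)
  finally have SG: "(A ** U1 ** B) ** G = mat 1"
    by (simp add: U' A')
  have G: "G ** (A ** M ** B) = B' ** (U' ** M) ** B" for M
  proof -
    have "G ** (A ** M ** B) = B' ** U' ** (A' ** A) ** M ** B"
      unfolding G_def by (simp only: matrix_mul_assoc)
    then show ?thesis
      by (simp add: A' matrix_mul_assoc)
  qed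
  have GS: "G ** (A ** U1 ** B) = mat 1"
    by (simp add: G U' B')
  have Y: "partial_monomial (B' ** V ** B)" "hollow (B' ** V ** B)"
    using partial_monomial_inverse_mult[OF S(1) SG GS S(2)] hollow_inverse_mult[OF S(1) SG GS D(1)]
    by (simp_all add: G V_def)
  have Z: "partial_monomial (B' ** W ** B)" "hollow (B' ** W ** B)"
    using partial_monomial_inverse_mult[OF S(1) SG GS S(3)] hollow_inverse_mult[OF S(1) SG GS D(2)]
    by (simp_all add: G W_def)
  have YZ: "disjoint_support (B' ** V ** B) (B' ** W ** B)"
    using disjoint_support_inverse_mult[OF S(1) SG GS D(3)] by (simp add: G V_def W_def)
  have U1V: "U1 ** V = U2" "U1 ** W = U3"
    by (simp_all add: V_def W_def matrix_mul_assoc U')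
  have V: "upper3 V" and W: "upper3 W"
    using upper3_left_cancel[OF U(1) nz] U by (simp_all add: U1V)
  have "U1 ** (mat v1 + mat v2 ** V + mat v3 ** W) = mat v1 ** U1 + mat v2 ** U2 + mat v3 ** U3"
    by (simp add: matrix_add_ldistrib mat_scale_commute matrix_mul_assoc)
      (simp add: matrix_mul_assoc[symmetric] U1V)
  then have N: "regular_or_corner (mat v1 + mat v2 ** V + mat v3 ** W)"
    using regular_or_corner_left_cancel[OF U(1) nz] E by simp
  \<comment> \<open>Hollow quotients are traceless, so only the identity term contributes, with
    trace \<open>3 * v1\<close>.\<close>
  have "trace V = 0" "trace W = 0"
    using hollow_trace[OF Y(2)] hollow_trace[OF Z(2)] trace_conjugate[OF B'(2)] by auto
  moreover have "trace (mat v1 + mat v2 ** V + mat v3 ** W) = 3 * v1 + v2 * trace V + v3 * trace W"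
    by (simp add: trace_def sum_3 mat_scale algebra_simps) (simp add: mat_def)
  moreover have "trace (mat v1 + mat v2 ** V + mat v3 ** W) = 0"
    using N hollow_trace unfolding regular_or_corner_def by blast
  ultimately have "v1 = 0"
    by simp
  moreover have "mat 0 = (0 :: complex^3^3)"
    by (simp add: mat_def vec_eq_iff)
  ultimately have "regular_or_corner (mat v2 ** V + mat v3 ** W)"
    using N by simp
  then have "hollow V \<and> hollow W"
    using hollow_pencil[OF B'(2,1) Y Z YZ V W] by blast
  then show ?thesis
    using upper3_mult_diag[OF U(1) V] upper3_mult_diag[OF U(1) W] unfolding hollow_def U1V by simp
qed

section \<open>Slices of tensors and the criterion\<close>

definition contract3 :: "tensor \<Rightarrow> complex^3 \<Rightarrow> complex^3^3" where
  "contract3 T z = (\<chi> i j. \<Sum>k\<in>UNIV. z $ k * T $ i $ j $ k)"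

lemma slice_tensor_act:
  "(\<chi> i j. tensor_act A B C T $ i $ j $ k) = A ** contract3 T (C $ k) ** transpose B"
  by (simp add: tensor_act_def contract3_def vec_eq_iff matrix_matrix_mult_def transpose_def
      sum_3 algebra_simps)

text \<open>Each forbidden pair of nonzero entries would be a pair of triples differing in exactly
  one coordinate.\<close>

lemma free_triples_slices:
  assumes "free_triples (tensor_supp T)"
  shows "partial_monomial (\<chi> i j. T $ i $ j $ k)"
    and "k \<noteq> l \<Longrightarrow> disjoint_support (\<chi> i j. T $ i $ j $ k) (\<chi> i j. T $ i $ j $ l)"
  using assms
  unfolding free_triples_def tensor_supp_def partial_monomial_def disjoint_support_def
  by fastforce+

text \<open>For nonzero vectors \<open>u\<close>, \<open>v\<close> on different root lines,
  \<open>f\<close> at \<open>s u + t v\<close> is \<open>s t\<close> times a linear form with both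
  coefficients nonzero, as the third line contains neither vector. The two squares would then
  differ.\<close>

lemma binary_cubic_roots:
  fixes a b c d :: complex
  defines "f \<equiv> \<lambda>s t. s * t * (s + t)"
  assumes "f a b = 0" "f c d = 0" "(f (a + c) (b + d))\<^sup>2 = (f (a - c) (b - d))\<^sup>2"
  shows "a * d = b * c"
proof -
  have "a = 0 \<or> b = 0 \<or> b = - a" "c = 0 \<or> d = 0 \<or> d = - c"
    using assms(2,3) unfolding f_def by (auto simp: eq_neg_iff_add_eq_0 add.commute)
  moreover have "(f (a + c) (b + d))\<^sup>2 - (f (a - c) (b - d))\<^sup>2 = 0"
    using assms(4) by simp
  ultimately show ?thesis
    unfolding f_def
    by (elim disjE; simp add: power2_eq_square; auto simp: algebra_simps)
qed

lemma not_free_if_upper3_slices: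
  fixes U :: "complex^3 \<Rightarrow> complex^3^3" and J :: "complex^3^3"
  assumes T: "\<And>z. contract3 T z = U z ** J" and J: "invertible J"
    and upper: "\<And>z. upper3 (U z)"
    and hollow: "\<And>z. hollow (U z) \<Longrightarrow> z $ 1 = 0 \<and> z $ 2 = 0"
    and det: "\<And>z. det (U z) = z $ 1 * z $ 2 * (z $ 1 + z $ 2)"
    and lin: "\<And>x y. U (x + y) = U x + U y" "\<And>c x. U (c *s x) = mat c ** U x"
    and E: "regular_or_corner (U (axis 3 1))"
  shows "\<not> free_tensor T"
proof
  assume "free_tensor T"
  then obtain A B C where ABC: "invertible A" "invertible B" "invertible C"
    and free: "free_triples (tensor_supp (tensor_act A B C T))"
    unfolding free_tensor_def by blast
  define R where "R = J ** transpose B"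
  have R: "invertible R"
    unfolding R_def using J ABC by (simp add: invertible_det_nz det_mul det_transpose)
  define S where "S = (\<lambda>k. A ** U (C $ k) ** R)"
  have slice: "(\<chi> i j. tensor_act A B C T $ i $ j $ k) = S k" for k
    by (simp add: slice_tensor_act T S_def R_def matrix_mul_assoc)
  have S: "partial_monomial (S k)" "k \<noteq> l \<Longrightarrow> disjoint_support (S k) (S l)" for k l
    using free_triples_slices[OF free] unfolding slice by blast+
  have detAR: "det A \<noteq> 0" "det R \<noteq> 0"
    using ABC R by (simp_all add: invertible_det_nz)
  have detC: "det C \<noteq> 0"
    using ABC by (simp add: invertible_det_nz)
  obtain C' where C': "C' ** C = mat 1"
    using ABC unfolding invertible_def by blast
  \<comment> \<open>Row 3 of the inverse of \<open>C\<close> expands the third basis vector in the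
    rows of \<open>C\<close>.\<close>
  have "axis 3 1 = C' $ 3 $ 1 *s C $ 1 + C' $ 3 $ 2 *s C $ 2 + C' $ 3 $ 3 *s C $ 3"
  proof -
    have "(C' ** C) $ 3 $ i = axis 3 1 $ i" for i
      by (simp add: C' mat_def axis_def)
    then show ?thesis
      by (simp add: vec_eq_iff matrix_matrix_mult_def sum_3)
  qed
  then have E': "regular_or_corner (\<Sum>k\<in>UNIV. mat (C' $ 3 $ k) ** U (C $ k))"
    using E by (simp only: lin sum_3)
  have singular: "det (U (C $ k)) = 0" for k
  proof (rule ccontr)
    assume nz: "det (U (C $ k)) \<noteq> 0"
    obtain l where l: "k \<noteq> l"
      using ex_third_3 by metis
    obtain m where m: "l \<noteq> m" "k \<noteq> m"
      using ex_third_3 by metis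
    have "hollow (U (C $ l)) \<and> hollow (U (C $ m))"
      by (rule hollow_of_invertible_slice[OF ABC(1) R _ _ _ _ _ _ upper upper upper nz
            E'[unfolded sum_distinct_3[OF l m]]])
        (use l m S in \<open>simp_all add: S_def\<close>)
    then have "C $ l $ 1 = 0" "C $ l $ 2 = 0" "C $ m $ 1 = 0" "C $ m $ 2 = 0"
      using hollow by blast+
    \<comment> \<open>Two rows of \<open>C\<close> are multiples of the third basis vector.\<close>
    then have "det C = 0"
      using exhaust_3[of l] exhaust_3[of m] m(1) by (auto simp: det_3)
    then show False
      using detC by simp
  qed
  have "C $ k $ 1 * C $ l $ 2 = C $ k $ 2 * C $ l $ 1" if "k \<noteq> l" for k l
  proof -
    have neg: "U (x - y) = U x - U y" for x y
      using lin(1)[of "x - y" y] by simp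
    have "S k + S l = A ** U (C $ k + C $ l) ** R" "S k - S l = A ** U (C $ k - C $ l) ** R"
      unfolding S_def lin neg
      by (simp_all add: vec_eq_iff matrix_matrix_mult_def sum_distrib_right sum.distrib
          sum_subtractf distrib_left distrib_right left_diff_distrib right_diff_distrib)
    moreover have "det (S j) = 0" for j
      by (simp add: S_def det_mul singular)
    ultimately have "(det A * det (U (C $ k + C $ l)) * det R)\<^sup>2 =
        (det A * det (U (C $ k - C $ l)) * det R)\<^sup>2"
      using det_add_diff_squares[OF S(1)[of k] _ S(1)[of l] _ S(2)[OF that]] by (simp add: det_mul)
    then have "(det (U (C $ k + C $ l)))\<^sup>2 = (det (U (C $ k - C $ l)))\<^sup>2"
      using detAR by (simp add: power_mult_distrib)
    then show ?thesis
      using binary_cubic_roots[of "C $ k $ 1" "C $ k $ 2" "C $ l $ 1" "C $ l $ 2"]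
        singular[of k] singular[of l] by (simp add: det)
  qed
  note minors = this[of 1 2] this[of 2 3] this[of 1 3]
  \<comment> \<open>Expansion along the third column; all minors of the first two columns
    vanish.\<close>
  have "det C = C$3$3 * (C$1$1 * C$2$2 - C$1$2 * C$2$1) - C$2$3 * (C$1$1 * C$3$2 - C$1$2 * C$3$1)
      + C$1$3 * (C$2$1 * C$3$2 - C$2$2 * C$3$1)"
    unfolding det_3 by (simp add: algebra_simps)
  also have "\<dots> = 0"
    using minors by simp
  finally show False
    using detC by simp
qed

section \<open>The two tensors\<close>

definition reversal :: "complex^3^3" where
  "reversal = (\<chi> i j. if (i, j) \<in> {(1, 3), (2, 2), (3, 1)} then 1 else 0)"

lemma invertible_reversal: "invertible reversal"
  unfolding invertible_det_nz reversal_def by (simp add: det_3)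

lemma not_free_T2: "\<not> free_tensor T2"
proof (rule not_free_if_upper3_slices)
  define U :: "complex^3 \<Rightarrow> complex^3^3" where
    "U z = vector [vector [z$2, z$3, 0], vector [0, z$1 + z$2, z$3], vector [0, 0, z$1]]" for z
  note simps = U_def vec_eq_iff forall_3
  show "contract3 T2 z = U z ** reversal" for z
    by (simp add: simps contract3_def T2_def tensor_basis_def pure_tensor_def axis_def sum_3
        matrix_matrix_mult_def reversal_def)
  show "upper3 (U z)" for z
    by (simp add: U_def upper3_def)
  show "hollow (U z) \<Longrightarrow> z $ 1 = 0 \<and> z $ 2 = 0" for z
    by (simp add: U_def hollow_def forall_3)
  show "det (U z) = z $ 1 * z $ 2 * (z $ 1 + z $ 2)" for z
    by (simp add: U_def det_3 algebra_simps)
  show "U (x + y) = U x + U y" for x y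
    by (simp add: simps)
  show "U (c *s x) = mat c ** U x" for c x
    by (simp add: simps mat_scale algebra_simps)
  show "regular_or_corner (U (axis 3 1))"
    by (simp add: U_def regular_or_corner_def upper3_def hollow_def forall_3 axis_def)
qed (rule invertible_reversal)

lemma not_free_T5: "\<not> free_tensor T5"
proof (rule not_free_if_upper3_slices)
  define U :: "complex^3 \<Rightarrow> complex^3^3" where
    "U z = vector [vector [z$1 + z$2, 0, z$3], vector [0, z$1, 0], vector [0, 0, z$2]]" for z
  note simps = U_def vec_eq_iff forall_3
  show "contract3 T5 z = U z ** reversal" for z
    by (simp add: simps contract3_def T5_def tensor_basis_def pure_tensor_def axis_def sum_3
        matrix_matrix_mult_def reversal_def)
  show "upper3 (U z)" for z
    by (simp add: U_def upper3_def)
  show "hollow (U z) \<Longrightarrow> z $ 1 = 0 \<and> z $ 2 = 0" for z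
    by (simp add: U_def hollow_def forall_3)
  show "det (U z) = z $ 1 * z $ 2 * (z $ 1 + z $ 2)" for z
    by (simp add: U_def det_3 algebra_simps)
  show "U (x + y) = U x + U y" for x y
    by (simp add: simps)
  show "U (c *s x) = mat c ** U x" for c x
    by (simp add: simps mat_scale algebra_simps)
  show "regular_or_corner (U (axis 3 1))"
    by (simp add: U_def regular_or_corner_def upper3_def hollow_def forall_3 axis_def)
qed (rule invertible_reversal)

theorem theorem4p1: "\<not> free_tensor T2 \<and> \<not> free_tensor T5"
  using not_free_T2 not_free_T5 by blast

end
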